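(* Let $G$ be a regular graph of order $n$ and diameter $D$. If $H$ is a proper subgraph of $G$, then \[ \mu(G)-\mu(H)>\frac{1}{nD}. \]
   Context: All graphs are finite and simple. For a graph $F$, $\mu(F)$ denotes the largest eigenvalue of the adjacency matrix of $F$. A graph of diameter $D$ is connected, and $D$ is the maximum over pairs of vertices of the length of a shortest path joining them. A proper subgraph of $G$ is a subgraph of $G$ different from $G$. *)

theory Defs
  imports "Jordan_Normal_Form.Spectral_Radius" "Graph_Theory.Graph_Theory"
begin

text \<open>
  Finite simple graphs are rendered by the locale predicate \<^term>\<open>pair_graph\<close>: an undirected edge
  between u and v is the pair of opposite arcs (u,v) and (v,u). In particular the
  out-degree of a vertex is its degree, and the length of an arc path is its number of edges.
\<close>

definition regular_graph :: "'a pair_pre_digraph \<Rightarrow> bool" where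
  "regular_graph G \<longleftrightarrow> (\<exists>d. \<forall>v \<in> pverts G. out_degree (with_proj G) v = d)"

definition graph_dist :: "'a pair_pre_digraph \<Rightarrow> 'a \<Rightarrow> 'a \<Rightarrow> nat" where
  "graph_dist G u v = (LEAST k. \<exists>p. pre_digraph.apath (with_proj G) u p v \<and> length p = k)"

text \<open>Only meaningful for (nonempty) connected finite graphs.\<close>

definition diameter :: "'a pair_pre_digraph \<Rightarrow> nat" where
  "diameter G = Max {graph_dist G u v | u v. u \<in> pverts G \<and> v \<in> pverts G}"

definition vertex_list :: "'a pair_pre_digraph \<Rightarrow> 'a list" where
  "vertex_list G = (SOME vs. distinct vs \<and> set vs = pverts G)"

text \<open>
  The matrix depends on the chosen enumeration of the vertices only up to simultaneous permutation
  of rows and columns, so its spectrum does not depend on that choice.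
\<close>

definition adjacency_matrix :: "'a pair_pre_digraph \<Rightarrow> real mat" where
  "adjacency_matrix G =
     (let vs = vertex_list G; n = length vs
      in mat n n (\<lambda>(i, j). if (vs ! i, vs ! j) \<in> parcs G then 1 else 0))"

text \<open>
  The spectrum is taken over the reals. It is finite, and nonempty as soon as the graph has a vertex
  because the matrix is symmetric; for the null graph the value is meaningless.
\<close>

definition largest_eigenvalue :: "'a pair_pre_digraph \<Rightarrow> real" where
  "largest_eigenvalue G = Max (spectrum (adjacency_matrix G))"

end

(* Let G be d-regular, so that mu(G) >= d, and let y be the absolute value of an eigenvector of H for
   mu(H), extended by 0. Then (d - mu(H)) |y|^2 is at least the sum of (y_a - y_b)^2 over the edges
   ab of G plus the sum of 2 y_a y_b over the edges ab missing in H. By Cauchy-Schwarz along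
   geodesics that start at a maximum of y, this is at least (max y)^2 / D >= |y|^2 / (nD): the
   geodesics lead to a zero of y or to a missing edge uv, whose two terms add up to y_u^2 + y_v^2.
   The last inequality is strict unless y is constant, in which case the edge uv contributes
   2 (max y)^2. *)

theory Submission
  imports Defs "HOL-Analysis.Convex"
begin

section \<open>Distances and geodesics in a relation\<close>

text \<open>Distance by walks: a walk of least length repeats no vertex, and powers of a relation
  compose by \<open>relpow_add\<close>. The value is meaningful only if some walk leads from
  \<open>w\<close> to \<open>v\<close>.\<close>

definition rel_dist :: "('a \<times> 'a) set \<Rightarrow> 'a \<Rightarrow> 'a \<Rightarrow> nat" where
  "rel_dist E w v = (LEAST k. (w, v) \<in> E ^^ k)"

lemma rel_dist_le: "(w, v) \<in> E ^^ k \<Longrightarrow> rel_dist E w v \<le> k"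
  unfolding rel_dist_def by (rule Least_le)

lemma rel_dist_relpow: "(w, v) \<in> E ^^ k \<Longrightarrow> (w, v) \<in> E ^^ rel_dist E w v"
  unfolding rel_dist_def by (rule LeastI)

lemma relpow_segment:
  assumes "\<And>i. i < k \<Longrightarrow> (f i, f (Suc i)) \<in> E" "i + m \<le> k"
  shows "(f i, f (i + m)) \<in> E ^^ m"
  using assms(2)
proof (induction m)
  case (Suc m)
  then show ?case using assms(1)[of "i + m"] by (auto intro: relcompI)
qed simp

text \<open>If \<open>f i\<close> were closer to \<open>w\<close> than \<open>i\<close>, a shortest
  walk to it followed by the remaining arcs of \<open>f\<close> would be too short. The last
  property makes the distance from \<open>w\<close> a level function that rises by one along each
  arc.\<close>

lemma obtain_geodesic:
  assumes "(w, v) \<in> E ^^ m"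
  obtains f where "f 0 = w" "f (rel_dist E w v) = v"
    "\<And>i. i < rel_dist E w v \<Longrightarrow> (f i, f (Suc i)) \<in> E"
    "\<And>i. i \<le> rel_dist E w v \<Longrightarrow> rel_dist E w (f i) = i"
proof -
  let ?k = "rel_dist E w v"
  obtain f where f: "f 0 = w" "f ?k = v" "\<And>i. i < ?k \<Longrightarrow> (f i, f (Suc i)) \<in> E"
    using rel_dist_relpow[OF assms] unfolding relpow_fun_conv by auto
  have "rel_dist E w (f i) = i" if i: "i \<le> ?k" for i
  proof -
    have wi: "(w, f i) \<in> E ^^ i"
      using relpow_segment[of ?k f E 0 i] f i by simp
    have iv: "(f i, v) \<in> E ^^ (?k - i)"
      using relpow_segment[of ?k f E i "?k - i"] f i by simp
    have "(w, v) \<in> E ^^ (rel_dist E w (f i) + (?k - i))"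
      unfolding relpow_add using rel_dist_relpow[OF wi] iv by blast
    then have "?k \<le> rel_dist E w (f i) + (?k - i)" by (rule rel_dist_le)
    with rel_dist_le[OF wi] i show ?thesis by linarith
  qed
  with f that show ?thesis by blast
qed

section \<open>Energy along levelled paths\<close>

text \<open>\<open>S\<close> and its converse are disjoint subsets of \<open>E\<close> with the same
  sum. The factor 2 reflects that \<open>E\<close> holds each edge as two opposite arcs.\<close>

lemma sum_orientation_le:
  fixes \<phi> :: "'a \<times> 'a \<Rightarrow> real"
  assumes "finite E" "sym E" "S \<subseteq> E" "S \<inter> S\<inverse> = {}"
    and "\<And>a b. \<phi> (a, b) = \<phi> (b, a)" "\<And>e. 0 \<le> \<phi> e"
  shows "2 * sum \<phi> S \<le> sum \<phi> E"
proof -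
  have fin: "finite S" using assms(1,3) finite_subset by blast
  have "sum \<phi> (S\<inverse>) = sum \<phi> S"
    by (rule sum.reindex_bij_witness[of _ prod.swap prod.swap]) (auto simp: assms(5))
  then have "2 * sum \<phi> S = sum \<phi> (S \<union> S\<inverse>)"
    using fin assms(4) by (simp add: sum.union_disjoint)
  also have "\<dots> \<le> sum \<phi> E"
    using assms by (intro sum_mono2) (auto dest: symD)
  finally show ?thesis .
qed

text \<open>Every arc of step \<open>i\<close> goes from level \<open>i\<close> to level
  \<open>i + 1\<close>, so arcs of different steps differ and no arc occurs along with its reverse.
  The pair is a set: an arc common to both paths counts once.\<close>

lemma sum_two_levelled_paths_le:
  fixes \<phi> :: "'a \<times> 'a \<Rightarrow> real" and l :: "'a \<Rightarrow> nat"
  assumes "finite E" "sym E"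
    and "\<And>a b. \<phi> (a, b) = \<phi> (b, a)" "\<And>e. 0 \<le> \<phi> e"
    and f: "\<And>i. i < k \<Longrightarrow> (f i, f (Suc i)) \<in> E" "\<And>i. i \<le> k \<Longrightarrow> l (f i) = i"
    and g: "\<And>i. i < k \<Longrightarrow> (g i, g (Suc i)) \<in> E" "\<And>i. i \<le> k \<Longrightarrow> l (g i) = i"
  shows "2 * (\<Sum>i<k. sum \<phi> {(f i, f (Suc i)), (g i, g (Suc i))}) \<le> sum \<phi> E"
proof -
  let ?S = "\<lambda>i. {(f i, f (Suc i)), (g i, g (Suc i))}"
  have lev: "l (fst e) = i \<and> l (snd e) = Suc i" if "i < k" "e \<in> ?S i" for i e
    using that f(2)[of i] f(2)[of "Suc i"] g(2)[of i] g(2)[of "Suc i"] by auto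
  have "(\<Sum>i<k. sum \<phi> (?S i)) = sum \<phi> (\<Union>i<k. ?S i)"
  proof (rule sum.UNION_disjoint[symmetric])
    show "\<forall>i\<in>{..<k}. \<forall>j\<in>{..<k}. i \<noteq> j \<longrightarrow> ?S i \<inter> ?S j = {}"
    proof (intro ballI impI equals0I)
      fix i j e assume "i \<in> {..<k}" "j \<in> {..<k}" "i \<noteq> j" "e \<in> ?S i \<inter> ?S j"
      then have "l (fst e) = i" "l (fst e) = j" using lev[of i e] lev[of j e] by auto
      with \<open>i \<noteq> j\<close> show False by simp
    qed
  qed auto
  moreover have "2 * sum \<phi> (\<Union>i<k. ?S i) \<le> sum \<phi> E"
  proof (rule sum_orientation_le)
    show "(\<Union>i<k. ?S i) \<subseteq> E" using f(1) g(1) by auto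
    have up: "l b = Suc (l a)" if "(a, b) \<in> (\<Union>i<k. ?S i)" for a b
    proof -
      from that obtain i where "i < k" "(a, b) \<in> ?S i" by blast
      from lev[OF this] show ?thesis by simp
    qed
    show "(\<Union>i<k. ?S i) \<inter> (\<Union>i<k. ?S i)\<inverse> = {}"
    proof (rule equals0I)
      fix e assume "e \<in> (\<Union>i<k. ?S i) \<inter> (\<Union>i<k. ?S i)\<inverse>"
      then obtain a b where "(a, b) \<in> (\<Union>i<k. ?S i)" "(b, a) \<in> (\<Union>i<k. ?S i)"
        by (cases e) blast
      from this[THEN up] show False by simp
    qed
  qed (use assms in auto)
  ultimately show ?thesis by simp
qed

lemma telescope_Cauchy_Schwarz:
  fixes h :: "nat \<Rightarrow> real"
  shows "(h 0 - h k)\<^sup>2 \<le> real k * (\<Sum>i<k. (h i - h (Suc i))\<^sup>2)"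
proof -
  have "h 0 - h k = (\<Sum>i<k. h i - h (Suc i))"
    by (induction k) auto
  then show ?thesis
    using sum_squared_le_sum_of_squares[of "\<lambda>i. h i - h (Suc i)" "{..<k}"]
    by (simp add: mult.commute)
qed

text \<open>Summed over arcs, so for symmetric \<open>E\<close> each edge counts twice; hence the
  halves below.\<close>

definition dirichlet_form :: "('a \<times> 'a) set \<Rightarrow> ('a \<Rightarrow> real) \<Rightarrow> real" where
  "dirichlet_form E y = (\<Sum>(a, b)\<in>E. (y a - y b)\<^sup>2)"

lemma dirichlet_form_nonneg: "0 \<le> dirichlet_form E y"
  unfolding dirichlet_form_def by (intro sum_nonneg) auto

lemma dirichlet_form_two_levelled_paths:
  fixes l :: "'a \<Rightarrow> nat"
  assumes "finite E" "sym E"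
    and f: "\<And>i. i < k \<Longrightarrow> (f i, f (Suc i)) \<in> E" "\<And>i. i \<le> k \<Longrightarrow> l (f i) = i"
    and g: "\<And>i. i < k \<Longrightarrow> (g i, g (Suc i)) \<in> E" "\<And>i. i \<le> k \<Longrightarrow> l (g i) = i"
  shows "2 * (\<Sum>i<k. \<Sum>(a, b)\<in>{(f i, f (Suc i)), (g i, g (Suc i))}. (y a - y b)\<^sup>2)
    \<le> dirichlet_form E y"
  unfolding dirichlet_form_def
  by (rule sum_two_levelled_paths_le[where l = l])
     (use assms in \<open>auto simp: power2_commute\<close>)

text \<open>The case of two equal paths, where each pair of arcs collapses to one arc.\<close>

lemma dirichlet_form_levelled_path:
  fixes l :: "'a \<Rightarrow> nat"
  assumes "finite E" "sym E"
    and f: "\<And>i. i < k \<Longrightarrow> (f i, f (Suc i)) \<in> E" "\<And>i. i \<le> k \<Longrightarrow> l (f i) = i"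
  shows "2 * (\<Sum>i<k. (y (f i) - y (f (Suc i)))\<^sup>2) \<le> dirichlet_form E y"
  using dirichlet_form_two_levelled_paths[OF assms(1,2) f f, where y = y] by simp

section \<open>Bounding a value of \<open>y\<close> by geodesics\<close>

text \<open>For the case that \<open>y\<close> vanishes at a vertex: Cauchy-Schwarz along a geodesic
  bounds the drop from \<open>y w\<close> to 0.\<close>

lemma path_to_zero_bound:
  assumes "finite E" "sym E" "(w, z) \<in> E ^^ k" "k \<le> D" "y z = 0"
  shows "2 * (y w)\<^sup>2 \<le> real D * dirichlet_form E y"
proof -
  obtain f where f: "f 0 = w" "f (rel_dist E w z) = z"
    "\<And>i. i < rel_dist E w z \<Longrightarrow> (f i, f (Suc i)) \<in> E"
    "\<And>i. i \<le> rel_dist E w z \<Longrightarrow> rel_dist E w (f i) = i"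
    using obtain_geodesic[OF assms(3)] by blast
  have "2 * (y w)\<^sup>2 \<le> real (rel_dist E w z) *
      (2 * (\<Sum>i<rel_dist E w z. (y (f i) - y (f (Suc i)))\<^sup>2))"
    using telescope_Cauchy_Schwarz[of "\<lambda>i. y (f i)" "rel_dist E w z"] f assms(5) by simp
  also have "\<dots> \<le> real D * dirichlet_form E y"
    using rel_dist_le[OF assms(3)] assms(4)
      dirichlet_form_levelled_path[OF assms(1,2) f(3,4), where y = y]
    by (intro mult_mono) (auto intro!: sum_nonneg)
  finally show ?thesis .
qed

text \<open>A geodesic to the end \<open>u\<close> that is not farther than \<open>v\<close> avoids
  the missing edge. One extra step from \<open>y u\<close> to 0 costs \<open>(y u)\<^sup>2\<close>,
  and the total length is still at most \<open>D\<close>.\<close>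

lemma path_to_edge_bound_near:
  assumes "finite E" "sym E" "(u, v) \<in> E" "u \<noteq> v" "(w, u) \<in> E ^^ k"
    and near: "rel_dist E w u < D" "rel_dist E w u \<le> rel_dist E w v"
  shows "(y w)\<^sup>2 \<le> real D * (dirichlet_form (E - {(u, v), (v, u)}) y / 2 + (y u)\<^sup>2)"
proof -
  let ?E = "E - {(u, v), (v, u)}" and ?k = "rel_dist E w u"
  obtain f where f: "f 0 = w" "f ?k = u"
    "\<And>i. i < ?k \<Longrightarrow> (f i, f (Suc i)) \<in> E"
    "\<And>i. i \<le> ?k \<Longrightarrow> rel_dist E w (f i) = i"
    using obtain_geodesic[OF assms(5)] by blast
  \<comment> \<open>If \<open>f i = v\<close>, then \<open>v\<close> is at distance
    \<open>i \<le> ?k\<close>, so \<open>i = ?k\<close> since \<open>v\<close> is no closer than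
    \<open>u\<close>; but \<open>f ?k = u\<close>.\<close>
  have nv: "f i \<noteq> v" if "i \<le> ?k" for i
    using f(2) f(4)[OF that] near(2) that \<open>u \<noteq> v\<close> by (cases "i = ?k") auto
  have path: "(f i, f (Suc i)) \<in> ?E" if "i < ?k" for i
    using f(3)[OF that] nv[of i] nv[of "Suc i"] that by auto
  have symE: "sym ?E" using \<open>sym E\<close> by (auto simp: sym_def)
  \<comment> \<open>The values along the geodesic, followed by the extra value 0 at index
    \<open>Suc ?k\<close>.\<close>
  define h where "h i = (if i \<le> ?k then y (f i) else 0)" for i
  have "(y w)\<^sup>2 \<le> real (Suc ?k) * (\<Sum>i<Suc ?k. (h i - h (Suc i))\<^sup>2)"
    using telescope_Cauchy_Schwarz[of h "Suc ?k"] f(1) by (simp add: h_def)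
  also have "(\<Sum>i<Suc ?k. (h i - h (Suc i))\<^sup>2)
      = (\<Sum>i<?k. (y (f i) - y (f (Suc i)))\<^sup>2) + (y u)\<^sup>2"
    using f(2) by (simp add: h_def)
  also have "real (Suc ?k) * \<dots> \<le> real D * (dirichlet_form ?E y / 2 + (y u)\<^sup>2)"
    using near(1) dirichlet_form_levelled_path[of ?E ?k f "rel_dist E w" y] symE path f(4) assms(1)
    by (intro mult_mono) (auto intro!: add_nonneg_nonneg sum_nonneg)
  finally show ?thesis .
qed

text \<open>When both ends of the missing edge are at distance \<open>D\<close>, a single geodesic only gives the
  factor \<open>D + 1\<close>. Averaging y along two geodesics saves the extra step: their last arcs differ, so
  the last step counts twice and can be merged with the jump to 0 over the missing edge.\<close>

lemma path_to_edge_bound_far: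
  assumes "finite E" "sym E" "u \<noteq> v" "(w, u) \<in> E ^^ k" "(w, v) \<in> E ^^ k'"
    and far: "rel_dist E w u = D" "rel_dist E w v = D" and "D > 0"
  shows "(y w)\<^sup>2 \<le> real D * (dirichlet_form (E - {(u, v), (v, u)}) y / 2 + (y u)\<^sup>2 + (y v)\<^sup>2)"
proof -
  let ?E = "E - {(u, v), (v, u)}"
  obtain f where f: "f 0 = w" "f D = u"
    "\<And>i. i < D \<Longrightarrow> (f i, f (Suc i)) \<in> E" "\<And>i. i \<le> D \<Longrightarrow> rel_dist E w (f i) = i"
    using obtain_geodesic[OF assms(4)] far by metis
  obtain g where g: "g 0 = w" "g D = v"
    "\<And>i. i < D \<Longrightarrow> (g i, g (Suc i)) \<in> E" "\<And>i. i \<le> D \<Longrightarrow> rel_dist E w (g i) = i"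
    using obtain_geodesic[OF assms(5)] far by metis
  \<comment> \<open>The tail of an arc of the geodesic has level below \<open>D\<close>, while both
    ends of the missing edge have level \<open>D\<close>.\<close>
  have pf: "(f i, f (Suc i)) \<in> ?E" if "i < D" for i
    using f(3)[OF that] f(4)[of i] that far by auto
  have pg: "(g i, g (Suc i)) \<in> ?E" if "i < D" for i
    using g(3)[OF that] g(4)[of i] that far by auto
  have symE: "sym ?E" using \<open>sym E\<close> by (auto simp: sym_def)
  obtain m where m: "D = Suc m" using \<open>D > 0\<close> gr0_implies_Suc by blast
  define s where
    "s i = (\<Sum>(a, b)\<in>{(f i, f (Suc i)), (g i, g (Suc i))}. (y a - y b)\<^sup>2)" for i
  define h where "h i = (y (f i) + y (g i)) / 2" for i
  have half: "2 * ((p + q) / 2)\<^sup>2 \<le> p\<^sup>2 + q\<^sup>2" for p q :: real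
    using sum_squares_bound[of p q] by (simp add: power2_eq_square field_simps)
  have hs: "2 * (h i - h (Suc i))\<^sup>2 \<le> s i"
    if "(f i, f (Suc i)) \<noteq> (g i, g (Suc i))" for i
  proof -
    have "h i - h (Suc i) = ((y (f i) - y (f (Suc i))) + (y (g i) - y (g (Suc i)))) / 2"
      by (simp add: h_def field_simps)
    moreover have "s i = (y (f i) - y (f (Suc i)))\<^sup>2 + (y (g i) - y (g (Suc i)))\<^sup>2"
      using that by (simp add: s_def)
    ultimately show ?thesis
      using half[of "y (f i) - y (f (Suc i))" "y (g i) - y (g (Suc i))"] by (simp only:)
  qed
  \<comment> \<open>On a common arc \<open>s i\<close> counts a single square, which equals that of
    the averaged step; the factor 2 of \<open>hs\<close> is lost there.\<close>
  have hs1: "(h i - h (Suc i))\<^sup>2 \<le> s i" for i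
  proof (cases "(f i, f (Suc i)) = (g i, g (Suc i))")
    case True
    then show ?thesis by (auto simp: s_def h_def)
  next
    case False
    from hs[OF this] show ?thesis using zero_le_power2[of "h i - h (Suc i)"] by linarith
  qed
  \<comment> \<open>The value 0 stands at index \<open>D\<close> in place of \<open>h D\<close>, so
    the descent takes \<open>D\<close> steps and not \<open>D + 1\<close>.\<close>
  define h' where "h' i = (if i < D then h i else 0)" for i
  have last: "(h m)\<^sup>2 \<le> s m + (y u)\<^sup>2 + (y v)\<^sup>2"
  proof -
    have "(f m, f (Suc m)) \<noteq> (g m, g (Suc m))" using f(2) g(2) m \<open>u \<noteq> v\<close> by auto
    from hs[OF this] have 1: "2 * (h m - h D)\<^sup>2 \<le> s m" using m by simp
    have 2: "2 * (h D)\<^sup>2 \<le> (y u)\<^sup>2 + (y v)\<^sup>2"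
      using half[of "y u" "y v"] f(2) g(2) by (simp add: h_def)
    \<comment> \<open>The two sides differ by \<open>(h m - 2 * h D)\<^sup>2\<close>.\<close>
    have "(h m)\<^sup>2 \<le> 2 * (h m - h D)\<^sup>2 + 2 * (h D)\<^sup>2"
      using zero_le_power2[of "h m - 2 * h D"] by (simp add: power2_eq_square algebra_simps)
    with 1 2 show ?thesis by linarith
  qed
  have "(y w)\<^sup>2 \<le> real D * (\<Sum>i<D. (h' i - h' (Suc i))\<^sup>2)"
    using telescope_Cauchy_Schwarz[of h' D] f(1) g(1) \<open>D > 0\<close> by (simp add: h'_def h_def)
  also have "(\<Sum>i<D. (h' i - h' (Suc i))\<^sup>2) = (\<Sum>i<m. (h i - h (Suc i))\<^sup>2) + (h m)\<^sup>2"
    by (simp add: m h'_def)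
  also have "\<dots> \<le> (\<Sum>i<m. s i) + (s m + (y u)\<^sup>2 + (y v)\<^sup>2)"
    by (intro add_mono sum_mono hs1 last)
  also have "\<dots> = (\<Sum>i<D. s i) + (y u)\<^sup>2 + (y v)\<^sup>2"
    by (simp add: m)
  also have "\<dots> \<le> dirichlet_form ?E y / 2 + (y u)\<^sup>2 + (y v)\<^sup>2"
    using dirichlet_form_two_levelled_paths[of ?E D f "rel_dist E w" g y] symE pf f(4) pg g(4)
      assms(1)
    by (simp add: s_def)
  finally show ?thesis by (simp add: mult_left_mono)
qed

text \<open>Either the nearer end of the edge is closer than \<open>D\<close>, or both ends are at
  distance exactly \<open>D\<close>.\<close>

lemma path_to_edge_bound:
  assumes "finite E" "sym E" "(u, v) \<in> E" "u \<noteq> v"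
    and "(w, u) \<in> E ^^ k" "k \<le> D" "(w, v) \<in> E ^^ k'" "k' \<le> D"
  shows "(y w)\<^sup>2 \<le> real D * (dirichlet_form (E - {(u, v), (v, u)}) y / 2 + (y u)\<^sup>2 + (y v)\<^sup>2)"
proof -
  have le: "rel_dist E w u \<le> D" "rel_dist E w v \<le> D"
    using assms(5-8) rel_dist_le le_trans by metis+
  \<comment> \<open>\<open>w\<close> differs from one end of the edge, and the walk to that end has
    positive length.\<close>
  have "w \<noteq> u \<or> w \<noteq> v" using \<open>u \<noteq> v\<close> by auto
  then have "k > 0 \<or> k' > 0" using assms(5,7) by (cases k; cases k') auto
  then have "D > 0" using assms(6,8) by auto
  consider "rel_dist E w u < D" "rel_dist E w u \<le> rel_dist E w v"
    | "rel_dist E w v < D" "rel_dist E w v \<le> rel_dist E w u"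
    | "rel_dist E w u = D" "rel_dist E w v = D"
    using le by linarith
  then show ?thesis
  proof cases
    case 1
    from path_to_edge_bound_near[OF assms(1-5) 1, of y]
    show ?thesis by (rule order_trans) (intro mult_left_mono, auto)
  next
    case 2
    have "(v, u) \<in> E" using assms(2,3) by (auto dest: symD)
    from path_to_edge_bound_near[OF assms(1,2) this _ assms(7) 2, of y] \<open>u \<noteq> v\<close>
    have "(y w)\<^sup>2 \<le> real D * (dirichlet_form (E - {(u, v), (v, u)}) y / 2 + (y v)\<^sup>2)"
      by (simp add: insert_commute)
    then show ?thesis by (rule order_trans) (intro mult_left_mono, auto)
  next
    case 3
    from path_to_edge_bound_far[OF assms(1,2,4,5,7) 3 \<open>D > 0\<close>] show ?thesis .
  qed
qed


section \<open>The spectral gap in terms of arc relations\<close>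

lemma sum_arcs_by_tail:
  fixes g :: "'a \<Rightarrow> real"
  assumes "finite V" "E \<subseteq> V \<times> V" "\<And>v. v \<in> V \<Longrightarrow> card (E `` {v}) = d"
  shows "(\<Sum>(a, b)\<in>E. g a) = real d * (\<Sum>v\<in>V. g v)"
proof -
  have "E = Sigma V (\<lambda>a. E `` {a})" using assms(2) by auto
  then have "(\<Sum>(a, b)\<in>E. g a) = (\<Sum>(a, b)\<in>Sigma V (\<lambda>a. E `` {a}). g a)" by simp
  also have "\<dots> = (\<Sum>a\<in>V. \<Sum>b\<in>E `` {a}. g a)"
    using assms(1,2) by (intro sum.Sigma[symmetric]) (auto intro: finite_subset)
  also have "\<dots> = real d * (\<Sum>v\<in>V. g v)"
    by (simp add: assms(3) sum_distrib_left)
  finally show ?thesis .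
qed

lemma sum_arcs_swap:
  fixes \<phi> :: "'a \<Rightarrow> 'a \<Rightarrow> real"
  assumes "sym E"
  shows "(\<Sum>(a, b)\<in>E. \<phi> a b) = (\<Sum>(a, b)\<in>E. \<phi> b a)"
  by (rule sum.reindex_bij_witness[of _ prod.swap prod.swap]) (use assms in \<open>auto dest: symD\<close>)

text \<open>Expansion of the squares: each \<open>(y v)\<^sup>2\<close> occurs \<open>d\<close>
  times with \<open>v\<close> as tail and \<open>d\<close> times with \<open>v\<close> as head. The
  result is twice the Laplacian form of \<open>d I - A\<close>.\<close>

lemma regular_dirichlet_form:
  assumes "finite V" "E \<subseteq> V \<times> V" "sym E" "\<And>v. v \<in> V \<Longrightarrow> card (E `` {v}) = d"
  shows "dirichlet_form E y = 2 * real d * (\<Sum>v\<in>V. (y v)\<^sup>2) - 2 * (\<Sum>(a, b)\<in>E. y a * y b)"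
proof -
  have "dirichlet_form E y = (\<Sum>e\<in>E. (\<lambda>(a, b). (y a)\<^sup>2) e + (\<lambda>(a, b). (y b)\<^sup>2) e
      - 2 * (\<lambda>(a, b). y a * y b) e)"
    unfolding dirichlet_form_def by (intro sum.cong) (auto simp: power2_diff)
  also have "\<dots> = (\<Sum>(a, b)\<in>E. (y a)\<^sup>2) + (\<Sum>(a, b)\<in>E. (y b)\<^sup>2)
      - 2 * (\<Sum>(a, b)\<in>E. y a * y b)"
    by (simp only: sum.distrib sum_subtractf sum_distrib_left)
  finally show ?thesis
    using sum_arcs_by_tail[OF assms(1,2,4), of "\<lambda>v. (y v)\<^sup>2"]
      sum_arcs_swap[OF assms(3), of "\<lambda>a b. (y a)\<^sup>2"] by simp
qed

text \<open>The edge contributes \<open>(y u - y v)\<^sup>2\<close> to half the form and, by its two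
  missing arcs, \<open>2 * (y u * y v)\<close> to the sum over \<open>E - F\<close>. The other
  missing arcs have nonnegative products and are dropped.\<close>

lemma missing_edge_energy:
  assumes "finite E" "sym E" "F \<subseteq> E" "sym F" "(u, v) \<in> E - F" "u \<noteq> v" "\<And>v. 0 \<le> y v"
  shows "dirichlet_form (E - {(u, v), (v, u)}) y / 2 + (y u)\<^sup>2 + (y v)\<^sup>2
    \<le> dirichlet_form E y / 2 + (\<Sum>(a, b)\<in>E - F. y a * y b)"
proof -
  let ?e = "{(u, v), (v, u)}"
  have e: "?e \<subseteq> E - F" using assms(2,4,5) by (auto dest: symD)
  have "dirichlet_form E y = dirichlet_form (E - ?e) y + dirichlet_form ?e y"
    unfolding dirichlet_form_def using e assms(1) by (intro sum.subset_diff) auto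
  moreover have "dirichlet_form ?e y = 2 * (y u - y v)\<^sup>2"
    using \<open>u \<noteq> v\<close> by (simp add: dirichlet_form_def power2_commute)
  moreover have "(\<Sum>(a, b)\<in>?e. y a * y b) \<le> (\<Sum>(a, b)\<in>E - F. y a * y b)"
    using e assms(1,7) by (intro sum_mono2) auto
  moreover have "(\<Sum>(a, b)\<in>?e. y a * y b) = 2 * (y u * y v)"
    using \<open>u \<noteq> v\<close> by (simp add: mult.commute)
  ultimately show ?thesis by (simp add: power2_diff add_divide_distrib diff_divide_distrib)
qed

text \<open>\<open>E\<close> and \<open>F\<close> stand for the arcs of the graph and of the
  subgraph, \<open>y\<close> for the absolute value of an eigenvector extended by 0. A missing
  vertex shows up as a zero of \<open>y\<close>, a missing edge as an arc of
  \<open>E - F\<close>.\<close>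

lemma regular_gap:
  fixes y :: "'a \<Rightarrow> real"
  assumes fin: "finite V" and E: "E \<subseteq> V \<times> V" "sym E" "\<And>a. (a, a) \<notin> E"
    and deg: "\<And>v. v \<in> V \<Longrightarrow> card (E `` {v}) = d"
    and diam: "\<And>u v. u \<in> V \<Longrightarrow> v \<in> V \<Longrightarrow> \<exists>k\<le>D. (u, v) \<in> E ^^ k"
    and F: "F \<subseteq> E" "sym F"
    and y: "\<And>v. 0 \<le> y v" "v\<^sub>0 \<in> V" "y v\<^sub>0 \<noteq> 0"
    and rayleigh: "\<mu> * (\<Sum>v\<in>V. (y v)\<^sup>2) \<le> (\<Sum>(a, b)\<in>F. y a * y b)"
    and proper: "(\<exists>z\<in>V. y z = 0) \<or> F \<noteq> E"
  shows "real d - \<mu> > 1 / (real (card V) * real D)"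
proof -
  define N where "N = (\<Sum>v\<in>V. (y v)\<^sup>2)"
  define R where "R = dirichlet_form E y / 2 + (\<Sum>(a, b)\<in>E - F. y a * y b)"
  have finE: "finite E" using fin E(1) finite_subset by blast
  have V: "V \<noteq> {}" "card V > 0" using y(2) fin by (auto simp: card_gt_0_iff)
  define M where "M = Max (y ` V)"
  have "M \<in> y ` V" unfolding M_def using fin V by (intro Max_in) auto
  then obtain w where w: "w \<in> V" "y w = M" by auto
  have le_M: "y v \<le> M" if "v \<in> V" for v unfolding M_def using fin that by simp
  have "M > 0" using le_M[OF y(2)] y(1)[of v\<^sub>0] y(3) by linarith
  have sq_le: "(y v)\<^sup>2 \<le> M\<^sup>2" if "v \<in> V" for v
    using le_M[OF that] y(1) by (rule power_mono)
  have "N > 0"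
    unfolding N_def using fin y by (intro sum_pos2[of _ v\<^sub>0]) auto
  have "(\<Sum>(a, b)\<in>E. y a * y b) = (\<Sum>(a, b)\<in>E - F. y a * y b) + (\<Sum>(a, b)\<in>F. y a * y b)"
    using F(1) finE by (rule sum.subset_diff)
  \<comment> \<open>By the expansion of the form, \<open>R\<close> equals \<open>d * N\<close> minus
    the sum over \<open>F\<close>, to which the Rayleigh bound applies.\<close>
  then have gap: "R \<le> (real d - \<mu>) * N"
    using rayleigh regular_dirichlet_form[OF fin E(1,2) deg, of y]
    by (simp add: R_def N_def algebra_simps)
  \<comment> \<open>The first conclusion is kept for the case of constant \<open>y\<close>;
    \<open>D = 0\<close> would force \<open>M = 0\<close>.\<close>
  have edge: "(y u)\<^sup>2 + (y v)\<^sup>2 \<le> R \<and> M\<^sup>2 \<le> real D * R \<and> D > 0"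
    if "(u, v) \<in> E - F" for u v
  proof -
    have uv: "u \<noteq> v" "u \<in> V" "v \<in> V" "(u, v) \<in> E" using that E by auto
    note energy = missing_edge_energy[of E F u v y, OF finE E(2) F that uv(1) y(1)]
    obtain k k' where "k \<le> D" "(w, u) \<in> E ^^ k" "k' \<le> D" "(w, v) \<in> E ^^ k'"
      using diam w(1) uv by metis
    then have "M\<^sup>2 \<le> real D * (dirichlet_form (E - {(u, v), (v, u)}) y / 2 + (y u)\<^sup>2 + (y v)\<^sup>2)"
      using path_to_edge_bound[OF finE E(2) uv(4,1)] w(2) by metis
    also have "\<dots> \<le> real D * R"
      using energy unfolding R_def by (intro mult_left_mono) auto
    finally have MR: "M\<^sup>2 \<le> real D * R" .
    moreover have "D > 0" using MR \<open>M > 0\<close> by (cases "D = 0") auto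
    ultimately show ?thesis
      using energy dirichlet_form_nonneg[of "E - {(u, v), (v, u)}" y] by (simp add: R_def)
  qed
  have zero: "M\<^sup>2 \<le> real D * R \<and> D > 0" if z: "z \<in> V" "y z = 0" for z
  proof -
    obtain k where "k \<le> D" "(w, z) \<in> E ^^ k" using diam w(1) z(1) by metis
    then have "2 * M\<^sup>2 \<le> real D * dirichlet_form E y"
      using path_to_zero_bound[OF finE E(2)] z(2) w(2) by metis
    also have "\<dots> \<le> real D * (2 * R)"
      using y(1) by (intro mult_left_mono) (auto simp: R_def intro!: sum_nonneg)
    finally show ?thesis using \<open>M > 0\<close> by (cases "D = 0") auto
  qed
  have main: "M\<^sup>2 \<le> real D * R" "D > 0"
    using proper edge zero F(1) by auto
  \<comment> \<open>If \<open>y\<close> is constant, it has no zero, so an edge is missing and gives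
    \<open>R \<ge> 2 * M\<^sup>2\<close>. Otherwise some value lies below \<open>M\<close> and
    \<open>N\<close> is strictly less than \<open>card V\<close> times
    \<open>M\<^sup>2\<close>.\<close>
  have "N < real (card V) * (real D * R)"
  proof (cases "\<forall>v\<in>V. y v = M")
    case True
    then have N: "N = real (card V) * M\<^sup>2" unfolding N_def by simp
    obtain u v where uv: "(u, v) \<in> E - F" using proper True \<open>M > 0\<close> F(1) by auto
    then have "u \<in> V" "v \<in> V" using E(1) by auto
    with True edge[OF uv] have "2 * M\<^sup>2 \<le> R" by auto
    moreover have "1 * R \<le> real D * R"
      using \<open>D > 0\<close> \<open>2 * M\<^sup>2 \<le> R\<close> zero_le_power2[of M] by (intro mult_right_mono) linarith+
    moreover have "M\<^sup>2 > 0" using \<open>M > 0\<close> by simp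
    ultimately have "M\<^sup>2 < real D * R" by linarith
    then show ?thesis unfolding N using V by simp
  next
    case False
    then obtain x where x: "x \<in> V" "y x < M" using le_M by force
    then have "(y x)\<^sup>2 < M\<^sup>2" using y(1) by (intro power_strict_mono) auto
    then have "N < (\<Sum>v\<in>V. M\<^sup>2)"
      unfolding N_def using fin x sq_le by (intro sum_strict_mono_ex1) auto
    also have "\<dots> \<le> real (card V) * (real D * R)" using main by (simp add: mult_left_mono)
    finally show ?thesis .
  qed
  also have "\<dots> \<le> real (card V) * (real D * ((real d - \<mu>) * N))"
    using gap by (intro mult_left_mono) auto
  finally have "1 * N < (real (card V) * real D * (real d - \<mu>)) * N" by (simp add: mult_ac)
  then have "1 < real (card V) * real D * (real d - \<mu>)"
    using \<open>N > 0\<close> mult_less_cancel_right_pos by blast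
  then show ?thesis using V \<open>D > 0\<close> by (simp add: field_simps)
qed

section \<open>Real eigenvalues of symmetric matrices\<close>

text \<open>A complex eigenvalue \<open>k\<close> exists. The Hermitian form of its eigenvector is
  \<open>k\<close> times a positive number and equals its own conjugate by symmetry, so
  \<open>k\<close> is real and hence a root of the characteristic polynomial of \<open>A\<close>
  itself.\<close>

lemma real_symmetric_spectrum_non_empty:
  fixes A :: "real mat"
  assumes A: "A \<in> carrier_mat n n" and "n > 0"
    and sym: "\<And>i j. i < n \<Longrightarrow> j < n \<Longrightarrow> A $$ (i, j) = A $$ (j, i)"
  shows "spectrum A \<noteq> {}"
proof -
  let ?B = "map_mat complex_of_real A"
  have B: "?B \<in> carrier_mat n n" using A by simp
  obtain k where k: "k \<in> spectrum ?B" using spectrum_non_empty[OF B \<open>n > 0\<close>] by blast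
  then obtain v where v: "v \<in> carrier_vec n" "v \<noteq> 0\<^sub>v n" "?B *\<^sub>v v = k \<cdot>\<^sub>v v"
    using A by (auto simp: spectrum_def eigenvalue_def eigenvector_def)
  have row: "(\<Sum>j<n. complex_of_real (A $$ (i, j)) * v $ j) = k * v $ i" if "i < n" for i
  proof -
    have "(?B *\<^sub>v v) $ i = (\<Sum>j<n. complex_of_real (A $$ (i, j)) * v $ j)"
      using that v(1) A by (auto simp: scalar_prod_def lessThan_atLeast0 intro!: sum.cong)
    then show ?thesis using v that by simp
  qed
  define q where "q = (\<Sum>i<n. \<Sum>j<n. complex_of_real (A $$ (i, j)) * (cnj (v $ i) * v $ j))"
  define s where "s = (\<Sum>i<n. (cmod (v $ i))\<^sup>2)"
  have "q = (\<Sum>i<n. cnj (v $ i) * (k * v $ i))"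
    unfolding q_def
  proof (intro sum.cong refl)
    fix i assume "i \<in> {..<n}"
    then show "(\<Sum>j<n. complex_of_real (A $$ (i, j)) * (cnj (v $ i) * v $ j)) = cnj (v $ i) * (k * v $ i)"
      by (simp add: row[symmetric] sum_distrib_left mult_ac)
  qed
  also have "\<dots> = k * complex_of_real s"
    unfolding s_def of_real_sum sum_distrib_left complex_norm_square by (simp add: mult_ac)
  finally have q: "q = k * complex_of_real s" .
  have "cnj q = (\<Sum>i<n. \<Sum>j<n. complex_of_real (A $$ (i, j)) * (cnj (v $ j) * v $ i))"
    by (simp add: q_def mult_ac)
  also have "\<dots> = (\<Sum>j<n. \<Sum>i<n. complex_of_real (A $$ (i, j)) * (cnj (v $ j) * v $ i))"
    by (rule sum.swap)
  also have "\<dots> = q" unfolding q_def by (intro sum.cong refl) (simp add: sym)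
  finally have "cnj k * complex_of_real s = k * complex_of_real s" using q by simp
  moreover have "s > 0"
  proof -
    obtain i where "i < n" "v $ i \<noteq> 0" using v(1,2) by (metis eq_vecI carrier_vecD index_zero_vec)
    then show ?thesis unfolding s_def by (intro sum_pos2[of _ i]) auto
  qed
  ultimately have "cnj k = k" by simp
  then obtain r where r: "k = complex_of_real r" by (metis Reals_cases Reals_cnj_iff)
  have "poly (char_poly ?B) k = 0" using k spectrum_root_char_poly[OF B] by simp
  then have "poly (char_poly A) r = 0"
    unfolding r of_real_hom.char_poly_hom[OF A] by simp
  then show ?thesis using spectrum_root_char_poly[OF A] by auto
qed

section \<open>Adjacency matrices and the diameter\<close>

context pair_graph
begin

lemma distinct_vertex_list: "distinct (vertex_list G)"
  and set_vertex_list: "set (vertex_list G) = pverts G"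
proof -
  have "\<exists>vs. distinct vs \<and> set vs = pverts G"
    using finite_distinct_list[OF pair_finite_verts] by blast
  then have "distinct (vertex_list G) \<and> set (vertex_list G) = pverts G"
    unfolding vertex_list_def by (rule someI_ex)
  then show "distinct (vertex_list G)" "set (vertex_list G) = pverts G" by auto
qed

lemma adjacency_matrix_carrier:
  "adjacency_matrix G \<in> carrier_mat (length (vertex_list G)) (length (vertex_list G))"
  by (simp add: adjacency_matrix_def Let_def)

lemma sym_parcs: "sym (parcs G)"
  using pair_sym_arcs by (simp add: symmetric_def)

text \<open>Frees a row of a matrix-vector product from the enumeration of the vertices: it becomes
  a sum over neighbours.\<close>

lemma adjacency_row_sum:
  assumes "u \<in> pverts G"
  shows "(\<Sum>j<length (vertex_list G).
      (if (u, vertex_list G ! j) \<in> parcs G then 1 else 0) * (x (vertex_list G ! j) :: real))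
    = (\<Sum>v\<in>parcs G `` {u}. x v)"
proof -
  let ?vs = "vertex_list G"
  have "(\<Sum>j<length ?vs. (if (u, ?vs ! j) \<in> parcs G then 1 else 0) * x (?vs ! j))
      = (\<Sum>v\<in>pverts G. (if (u, v) \<in> parcs G then 1 else 0) * x v)"
    using bij_betw_nth[OF distinct_vertex_list refl set_vertex_list[symmetric]]
    by (intro sum.reindex_bij_betw)
  also have "\<dots> = (\<Sum>v\<in>parcs G `` {u}. x v)"
    using pair_finite_verts
    by (intro sum.mono_neutral_cong_right) (auto dest: in_arcsD2)
  finally show ?thesis .
qed

lemma eigenvector_function:
  assumes "\<rho> \<in> spectrum (adjacency_matrix G)"
  obtains x where "\<And>u. u \<in> pverts G \<Longrightarrow> (\<Sum>v\<in>parcs G `` {u}. x v) = \<rho> * x u"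
    and "\<exists>u\<in>pverts G. x u \<noteq> 0"
proof -
  let ?vs = "vertex_list G" and ?n = "length (vertex_list G)"
  note A = adjacency_matrix_carrier
  obtain c where c: "c \<in> carrier_vec ?n" "c \<noteq> 0\<^sub>v ?n" "adjacency_matrix G *\<^sub>v c = \<rho> \<cdot>\<^sub>v c"
    using assms A by (auto simp: spectrum_def eigenvalue_def eigenvector_def)
  \<comment> \<open>The entry of \<open>c\<close> at the index of \<open>v\<close> in the
    enumeration, meaningful only for vertices.\<close>
  define x where "x v = c $ (the_inv_into {..<?n} ((!) ?vs) v)" for v
  have x: "x (?vs ! j) = c $ j" if "j < ?n" for j
    using that distinct_vertex_list by (simp add: x_def the_inv_into_f_f inj_on_nth)
  have "(\<Sum>v\<in>parcs G `` {u}. x v) = \<rho> * x u" if u: "u \<in> pverts G" for u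
  proof -
    obtain i where i: "i < ?n" "u = ?vs ! i" using u set_vertex_list by (metis in_set_conv_nth)
    have "(adjacency_matrix G *\<^sub>v c) $ i
        = (\<Sum>j<?n. (if (u, ?vs ! j) \<in> parcs G then 1 else 0) * x (?vs ! j))"
      using i c(1) x
      by (auto simp: adjacency_matrix_def Let_def scalar_prod_def lessThan_atLeast0 intro!: sum.cong)
    with adjacency_row_sum[OF u, of x] c(1,3) i x show ?thesis by simp
  qed
  moreover obtain i where "i < ?n" "c $ i \<noteq> 0"
    using c(1,2) by (metis eq_vecI carrier_vecD index_zero_vec)
  then have "\<exists>u\<in>pverts G. x u \<noteq> 0" using x set_vertex_list nth_mem by metis
  ultimately show ?thesis using that by blast
qed

text \<open>Shows that the \<open>Max\<close> is attained: the spectrum is finite, and nonempty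
  because the matrix is symmetric.\<close>

lemma largest_eigenvalue_in_spectrum:
  assumes "pverts G \<noteq> {}"
  shows "largest_eigenvalue G \<in> spectrum (adjacency_matrix G)"
  unfolding largest_eigenvalue_def
proof (rule Max_in)
  show "finite (spectrum (adjacency_matrix G))"
    using card_finite_spectrum[OF adjacency_matrix_carrier] by simp
  show "spectrum (adjacency_matrix G) \<noteq> {}"
  proof (rule real_symmetric_spectrum_non_empty[OF adjacency_matrix_carrier])
    show "length (vertex_list G) > 0" using assms set_vertex_list by auto
  qed (use sym_parcs in \<open>auto simp: adjacency_matrix_def Let_def dest: symD\<close>)
qed

text \<open>The all-ones vector is an eigenvector for \<open>d\<close>.\<close>

lemma regular_degree_le_largest_eigenvalue:
  assumes "pverts G \<noteq> {}" "\<And>u. u \<in> pverts G \<Longrightarrow> card (parcs G `` {u}) = d"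
  shows "real d \<le> largest_eigenvalue G"
  unfolding largest_eigenvalue_def
proof (rule Max_ge)
  let ?n = "length (vertex_list G)"
  let ?c = "vec ?n (\<lambda>i. 1 :: real)"
  show "finite (spectrum (adjacency_matrix G))"
    using card_finite_spectrum[OF adjacency_matrix_carrier] by simp
  have "adjacency_matrix G *\<^sub>v ?c = real d \<cdot>\<^sub>v ?c"
  proof (rule eq_vecI)
    fix i assume "i < dim_vec (real d \<cdot>\<^sub>v ?c)"
    then have i: "i < ?n" by simp
    then have u: "vertex_list G ! i \<in> pverts G" using set_vertex_list nth_mem by metis
    have "(adjacency_matrix G *\<^sub>v ?c) $ i
        = (\<Sum>j<?n. (if (vertex_list G ! i, vertex_list G ! j) \<in> parcs G then 1 else 0) * 1)"
      using i
      by (auto simp: adjacency_matrix_def Let_def scalar_prod_def lessThan_atLeast0 intro!: sum.cong)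
    with adjacency_row_sum[OF u, of "\<lambda>_. 1"] assms(2)[OF u] i
    show "(adjacency_matrix G *\<^sub>v ?c) $ i = (real d \<cdot>\<^sub>v ?c) $ i" by simp
  qed (use adjacency_matrix_carrier in simp)
  moreover have "?c \<noteq> 0\<^sub>v ?n"
  proof
    assume "?c = 0\<^sub>v ?n"
    then have "?c $ 0 = 0\<^sub>v ?n $ 0" by simp
    moreover have "?n > 0" using assms(1) set_vertex_list by auto
    ultimately show False by simp
  qed
  ultimately show "real d \<in> spectrum (adjacency_matrix G)"
    using adjacency_matrix_carrier
    by (auto simp: spectrum_def eigenvalue_def eigenvector_def intro!: exI[of _ ?c])
qed

lemma awalk_relpow: "awalk u p v \<Longrightarrow> (u, v) \<in> parcs G ^^ length p"
proof (induction p arbitrary: u)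
  case (Cons e p)
  then have "e \<in> parcs G" "fst e = u" "awalk (snd e) p v" by (auto simp: awalk_Cons_iff)
  with Cons.IH show ?case by (cases e) (auto simp del: relpow.simps intro: relpow_Suc_I2)
qed (simp add: awalk_Nil_iff)

text \<open>Links the path-based diameter to powers of the arc relation. Symmetry turns
  connectedness into strong connectedness, so the least path length is attained.\<close>

lemma relpow_le_diameter:
  assumes "Digraph_Component.connected (with_proj G)" "u \<in> pverts G" "v \<in> pverts G"
  shows "\<exists>k\<le>diameter G. (u, v) \<in> parcs G ^^ k"
proof -
  have "strongly_connected (with_proj G)"
    using assms(1) sym_arcs by (metis symmetric_connected_imp_strongly_connected)
  then have "u \<rightarrow>\<^sup>*\<^bsub>with_proj G\<^esub> v" using assms(2,3) by auto
  then have "\<exists>k p. apath u p v \<and> length p = k" unfolding reachable_apath by blast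
  then have "\<exists>p. apath u p v \<and> length p = graph_dist G u v"
    unfolding graph_dist_def by (rule LeastI_ex)
  then have "(u, v) \<in> parcs G ^^ graph_dist G u v"
    using awalk_relpow awalkI_apath by metis
  moreover have "graph_dist G u v \<le> diameter G"
    unfolding diameter_def
  proof (rule Max_ge)
    have "{graph_dist G u v |u v. u \<in> pverts G \<and> v \<in> pverts G}
        = (\<lambda>(u, v). graph_dist G u v) ` (pverts G \<times> pverts G)" by auto
    then show "finite {graph_dist G u v |u v. u \<in> pverts G \<and> v \<in> pverts G}"
      using pair_finite_verts by simp
  qed (use assms in auto)
  ultimately show ?thesis by blast
qed

end

section \<open>The gap between a regular graph and a proper subgraph\<close>

theorem theorem1:
  fixes G H :: "'a pair_pre_digraph" and n D :: nat
  assumes "pair_graph G"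
    and "regular_graph G"
    and "card (pverts G) = n"
    and "Digraph_Component.connected (with_proj G)"
    and "diameter G = D"
    and "pair_graph H"
    and "pverts H \<noteq> {}"
    and "subgraph (with_proj H) (with_proj G)"
    and "H \<noteq> G"
  shows "largest_eigenvalue G - largest_eigenvalue H > 1 / (real n * real D)"
proof -
  interpret G: pair_graph G by fact
  interpret H: pair_graph H by fact
  have sub: "pverts H \<subseteq> pverts G" "parcs H \<subseteq> parcs G"
    using assms(8) by (auto simp: subgraph_def)
  obtain d where "\<forall>v\<in>pverts G. out_degree (with_proj G) v = d"
    using assms(2) unfolding regular_graph_def by blast
  moreover have "out_degree (with_proj G) v = card (parcs G `` {v})" for v
    unfolding out_degree_def out_arcs_def
    by (rule bij_betw_same_card[of snd])
       (auto simp: bij_betw_def inj_on_def image_iff intro: rev_image_eqI)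
  ultimately have deg: "\<And>v. v \<in> pverts G \<Longrightarrow> card (parcs G `` {v}) = d" by simp
  define \<rho> where "\<rho> = largest_eigenvalue H"
  have "\<rho> \<in> spectrum (adjacency_matrix H)"
    unfolding \<rho>_def using H.largest_eigenvalue_in_spectrum assms(7) .
  then obtain x where x: "\<And>u. u \<in> pverts H \<Longrightarrow> (\<Sum>v\<in>parcs H `` {u}. x v) = \<rho> * x u"
    and x_nz: "\<exists>u\<in>pverts H. x u \<noteq> 0"
    using H.eigenvector_function by blast
  obtain v\<^sub>0 where v0: "v\<^sub>0 \<in> pverts H" "x v\<^sub>0 \<noteq> 0" using x_nz by blast
  \<comment> \<open>Vertices outside the subgraph become zeros of \<open>y\<close>.\<close>
  define y where "y v = (if v \<in> pverts H then \<bar>x v\<bar> else 0)" for v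
  have arcs_eq: "parcs H = Sigma (pverts H) (\<lambda>u. parcs H `` {u})"
    by (auto dest: H.in_arcsD1)
  \<comment> \<open>The eigenvalue equation paired with \<open>x\<close> gives an equality. Absolute
    values keep the squares and can only increase the products over arcs.\<close>
  have "\<rho> * (\<Sum>v\<in>pverts G. (y v)\<^sup>2) = \<rho> * (\<Sum>v\<in>pverts H. (x v)\<^sup>2)"
    using sub(1) G.pair_finite_verts
    by (intro arg_cong[where f = "(*) \<rho>"] sum.mono_neutral_cong_right) (auto simp: y_def)
  also have "\<dots> = (\<Sum>u\<in>pverts H. x u * (\<Sum>v\<in>parcs H `` {u}. x v))"
    by (simp add: x sum_distrib_left power2_eq_square mult_ac)
  also have "\<dots> = (\<Sum>u\<in>pverts H. \<Sum>v\<in>parcs H `` {u}. x u * x v)"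
    by (simp add: sum_distrib_left)
  also have "\<dots> = (\<Sum>(u, v)\<in>parcs H. x u * x v)"
    by (subst (2) arcs_eq, rule sum.Sigma)
       (auto simp: H.pair_finite_verts intro: finite_subset[OF _ H.pair_finite_verts] dest: H.in_arcsD2)
  also have "\<dots> \<le> (\<Sum>(u, v)\<in>parcs H. y u * y v)"
    by (intro sum_mono)
       (auto simp: y_def abs_mult[symmetric] dest: H.in_arcsD1 H.in_arcsD2)
  finally have rayleigh: "\<rho> * (\<Sum>v\<in>pverts G. (y v)\<^sup>2) \<le> (\<Sum>(u, v)\<in>parcs H. y u * y v)" .
  \<comment> \<open>If the vertex sets agree, the arc sets must differ; otherwise a vertex outside
    \<open>H\<close> is a zero of \<open>y\<close>.\<close>
  have proper: "(\<exists>z\<in>pverts G. y z = 0) \<or> parcs H \<noteq> parcs G"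
  proof (cases "pverts H = pverts G")
    case True
    with assms(9) show ?thesis by (auto intro: pair_pre_digraph.equality)
  next
    case False
    with sub(1) show ?thesis by (auto simp: y_def)
  qed
  have "real d - \<rho> > 1 / (real (card (pverts G)) * real (diameter G))"
  proof (rule regular_gap[OF G.pair_finite_verts _ G.sym_parcs _ deg _ sub(2) H.sym_parcs
        _ _ _ rayleigh proper])
    show "v\<^sub>0 \<in> pverts G" "y v\<^sub>0 \<noteq> 0" using v0 sub(1) by (auto simp: y_def)
    show "\<And>u v. u \<in> pverts G \<Longrightarrow> v \<in> pverts G \<Longrightarrow> \<exists>k\<le>diameter G. (u, v) \<in> parcs G ^^ k"
      using G.relpow_le_diameter[OF assms(4)] .
  qed (auto simp: y_def dest: G.in_arcsD1 G.in_arcsD2 G.no_loops')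
  moreover have "real d \<le> largest_eigenvalue G"
    using G.regular_degree_le_largest_eigenvalue[OF _ deg] assms(7) sub(1) by auto
  ultimately show ?thesis using assms(3,5) by (simp add: \<rho>_def)
qed

end
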